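(* Let $V$ be a finite set, $q\ge1$, and let $\varepsilon_1,\dots,\varepsilon_q$ be the primitive idempotents of $\mathbb C^q$, so $\varepsilon_\alpha\varepsilon_\beta=\delta_{\alpha\beta}\varepsilon_\alpha$. Let $w_{ij}=w_{ji}\in\mathbb C^q$ ($i,j\in V$) be symmetric weights with $w_{ii}=0$, and write $w_{ij}=\sum_{\alpha=1}^q w_{ij}^{(\alpha)}\varepsilon_\alpha$ with $w_{ij}^{(\alpha)}\in\mathbb C$. The graph bracket $[f,g]_i=\sum_j w_{ij}(f_ig_j-f_jg_i)$ on $(\mathbb C^q)^V$ satisfies the Jacobi identity if and only if, for every $\alpha\in\{1,\dots,q\}$, each connected component of the graph $$G_\alpha=\bigl(V,\{ij:\ w_{ij}^{(\alpha)}\neq0\}\bigr)$$ is an isolated vertex, a single edge, or a complete graph whose edges $ij$ all carry one common scalar weight $w_{ij}^{(\alpha)}$.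
   Context: $\mathbb C^q$ carries componentwise multiplication. The graph bracket is the $\mathbb C^q$-bilinear antisymmetric map on $(\mathbb C^q)^V$ given by $[f,g]_i=\sum_{j\in V}w_{ij}(f_ig_j-f_jg_i)$. The Jacobi identity is $[f,[g,h]]+[g,[h,f]]+[h,[f,g]]=0$ for all $f,g,h$. *)

theory Defs
  imports "Graph_Theory.Graph_Theory" "HOL-Analysis.Analysis"
begin

definition primitive_idempotent :: "'a::ring \<Rightarrow> bool" where
  "primitive_idempotent e \<longleftrightarrow> e * e = e \<and> e \<noteq> 0 \<and>
     \<not> (\<exists>a b. a * a = a \<and> b * b = b \<and> a * b = 0 \<and> b * a = 0 \<and> a \<noteq> 0 \<and> b \<noteq> 0 \<and> e = a + b)"

text \<open>
  The algebra is \<^typ>\<open>complex ^ 'q\<close> with the componentwise multiplication \<open>(*)\<close> of the library.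
  Elements of \<open>(complex ^ 'q)\<^sup>V\<close> are the extensional functions in \<open>V \<rightarrow>\<^sub>E UNIV\<close>.
\<close>

definition graph_bracket ::
  "'v set \<Rightarrow> ('v \<Rightarrow> 'v \<Rightarrow> complex ^ 'q) \<Rightarrow>
     ('v \<Rightarrow> complex ^ 'q) \<Rightarrow> ('v \<Rightarrow> complex ^ 'q) \<Rightarrow> 'v \<Rightarrow> complex ^ 'q" where
  "graph_bracket V w f g = (\<lambda>i\<in>V. \<Sum>j\<in>V. w i j * (f i * g j - f j * g i))"

definition jacobi_identity ::
  "'v set \<Rightarrow> (('v \<Rightarrow> 'a) \<Rightarrow> ('v \<Rightarrow> 'a) \<Rightarrow> ('v \<Rightarrow> 'a::ab_group_add)) \<Rightarrow> bool" where
  "jacobi_identity V br \<longleftrightarrow>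
     (\<forall>f \<in> V \<rightarrow>\<^sub>E UNIV. \<forall>g \<in> V \<rightarrow>\<^sub>E UNIV. \<forall>h \<in> V \<rightarrow>\<^sub>E UNIV. \<forall>i\<in>V.
        br f (br g h) i + br g (br h f) i + br h (br f g) i = 0)"

text \<open>
  Undirected graphs are represented as symmetric digraphs, so an edge \<open>ij\<close> gives the two arcs
  \<open>(i, j)\<close> and \<open>(j, i)\<close>. For the weights used below the relation is symmetric and loop-free.
\<close>

definition weight_graph :: "'v set \<Rightarrow> ('v \<Rightarrow> 'v \<Rightarrow> complex) \<Rightarrow> ('v, 'v \<times> 'v) pre_digraph" where
  "weight_graph V u = with_proj \<lparr> pverts = V, parcs = {(i, j). i \<in> V \<and> j \<in> V \<and> u i j \<noteq> 0} \<rparr>"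

definition connected_component_of_graph :: "('v, 'e) pre_digraph \<Rightarrow> ('v, 'e) pre_digraph \<Rightarrow> bool" where
  "connected_component_of_graph G H \<longleftrightarrow> pre_digraph.max_subgraph G Digraph_Component.connected H"

definition isolated_vertex :: "('v, 'e) pre_digraph \<Rightarrow> bool" where
  "isolated_vertex H \<longleftrightarrow> (\<exists>v. verts H = {v} \<and> arcs H = {})"

definition single_edge :: "('v, 'e) pre_digraph \<Rightarrow> bool" where
  "single_edge H \<longleftrightarrow> (\<exists>i j. i \<noteq> j \<and> verts H = {i, j} \<and> arcs_ends H = {(i, j), (j, i)})"

definition complete_with_common_weight ::
  "('v \<Rightarrow> 'v \<Rightarrow> complex) \<Rightarrow> ('v, 'e) pre_digraph \<Rightarrow> bool" where
  "complete_with_common_weight u H \<longleftrightarrow>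
     (\<exists>n. complete_digraph n H) \<and> (\<exists>c. \<forall>(i, j) \<in> arcs_ends H. u i j = c)"

end

theory Submission
  imports Defs
begin

text \<open>
  Write \<open>L\<close> for the weighted adjacency operator, so that \<open>[f,g] = f\<cdot>Lg - g\<cdot>Lf\<close>. In the cyclic sum
  only the terms \<open>f\<cdot>L[g,h]\<close> survive, hence the Jacobi identity at \<open>i\<close> says that the alternating form
  \<open>(g,h) \<mapsto> (L[g,h])\<^sub>i\<close> vanishes on vectors that are zero at \<open>i\<close>. Its coefficient at \<open>(j,k)\<close> is
  \<open>w\<^sub>j\<^sub>k (w\<^sub>i\<^sub>j - w\<^sub>i\<^sub>k)\<close>, so the Jacobi identity amounts to \<open>w\<^sub>j\<^sub>k (w\<^sub>i\<^sub>j - w\<^sub>i\<^sub>k) = 0\<close> for distinct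
  \<open>i, j, k\<close>. The primitive idempotents are the coordinate vectors, so this can be read in each
  scalar coordinate: a path \<open>i - j - k\<close> of edges closes up to a triangle of equal weights.
\<close>

section \<open>Primitive idempotents of the coordinate algebra\<close>

lemma idempotent_vec_nth:
  fixes e :: "complex ^ 'q"
  assumes "e * e = e"
  shows "e $ a = 0 \<or> e $ a = 1"
proof -
  have "e $ a * e $ a = e $ a"
    using assms by (metis vector_mult_component)
  then show ?thesis by simp
qed

text \<open>Coordinates of idempotents are 0 or 1. In a splitting \<open>x + y\<close> both summands
  therefore vanish off \<open>a\<close>, and at \<open>a\<close> orthogonality kills one of
  them.\<close>

lemma axis_primitive_idempotent: "primitive_idempotent (axis a 1 :: complex ^ 'q)"
proof -
  have False
    if x: "x * x = x" and y: "y * y = y" and xy: "x * y = 0"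
      and "x \<noteq> 0" "y \<noteq> 0" and sum: "axis a 1 = x + y" for x y :: "complex ^ 'q"
  proof -
    have off: "x $ b = 0 \<and> y $ b = 0" if "b \<noteq> a" for b
    proof -
      have "x $ b + y $ b = 0"
        using arg_cong[OF sum, of "\<lambda>v. v $ b"] that by (simp add: axis_def)
      then show ?thesis
        using idempotent_vec_nth[OF x, of b] idempotent_vec_nth[OF y, of b] by auto
    qed
    have "x $ a * y $ a = 0"
      using arg_cong[OF xy, of "\<lambda>v. v $ a"] by simp
    then have "x = 0 \<or> y = 0"
      using off by (metis mult_eq_0_iff vec_eq_iff zero_index)
    with \<open>x \<noteq> 0\<close> \<open>y \<noteq> 0\<close> show False by blast
  qed
  moreover have "axis a 1 * axis a 1 = (axis a 1 :: complex ^ 'q)"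
    by (simp add: vec_eq_iff axis_def)
  moreover have "axis a 1 \<noteq> (0 :: complex ^ 'q)"
    by (simp add: axis_eq_0_iff)
  ultimately show ?thesis
    unfolding primitive_idempotent_def by blast
qed

text \<open>A nonzero idempotent has a coordinate equal to 1. Splitting off the axis vector there
  leaves an orthogonal idempotent, which primitivity forces to be zero.\<close>

lemma primitive_idempotent_iff_axis:
  fixes e :: "complex ^ 'q"
  shows "primitive_idempotent e \<longleftrightarrow> (\<exists>a. e = axis a 1)"
proof
  assume prim: "primitive_idempotent e"
  then have idem: "e * e = e" and "e \<noteq> 0"
    by (simp_all add: primitive_idempotent_def)
  then obtain a where "e $ a \<noteq> 0"
    by (auto simp: vec_eq_iff)
  then have ea: "e $ a = 1"
    using idempotent_vec_nth[OF idem] by blast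
  define x :: "complex ^ 'q" where "x = axis a 1"
  define y where "y = e - x"
  have ex: "e * x = x" "x * e = x" "x * x = x"
    using ea by (auto simp: vec_eq_iff x_def axis_def)
  have "y * y = y" "x * y = 0" "y * x = 0"
    by (simp_all add: y_def algebra_simps ex idem)
  moreover have "x \<noteq> 0" "e = x + y"
    by (simp_all add: x_def y_def axis_eq_0_iff)
  ultimately have "y = 0"
    using prim ex(3) unfolding primitive_idempotent_def by blast
  then show "\<exists>a. e = axis a 1"
    by (auto simp: y_def x_def)
qed (auto intro: axis_primitive_idempotent)

section \<open>Connected components of symmetric digraphs\<close>

text \<open>An induced subgraph of a symmetric digraph is symmetric, so connectivity and strong
  connectivity agree on it. This makes the facts about \<open>sccs\<close> available for the
  components in the theorem.\<close>

lemma (in sym_digraph) max_connected_subgraph_eq_sccs: "{H. max_subgraph connected H} = sccs"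
proof -
  have conn: "connected H" if "strongly_connected H" for H :: "('a, 'b) pre_digraph"
    using that rtrancl_on_mono[OF _ order.refl, of "arcs_ends H" "(arcs_ends H)\<^sup>s"]
    by (auto simp: connected_conv strongly_connected_def reachable_def symcl_def)
  have mono: "arc_mono connected"
    unfolding arc_mono_def
    by (metis spanning_def subgraphE wf_digraph.connected_spanning_imp_connected)
  have strong: "strongly_connected H" if "induced_subgraph H G" "connected H" for H
    using that sym_arcs
    by (meson induced_graph_imp_symmetric wf_digraph.symmetric_connected_imp_strongly_connected
        wf_digraphI_induced)
  have "max_subgraph connected H" if H: "max_subgraph strongly_connected H" for H
  proof (rule max_subgraphI)
    show "connected H" "subgraph H G"
      using H conn by (auto simp: max_subgraph_def)
    fix K
    assume K: "H \<noteq> K" "subgraph H K" "subgraph K G"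
    show "\<not> connected K"
    proof
      assume "connected K"
      \<comment> \<open>\<open>K\<close> may contain an arc without its reverse and so be connected
        but not strongly connected. The subgraph induced on its vertices restores the missing
        arcs.\<close>
      let ?K = "G \<restriction> verts K"
      have ind: "induced_subgraph ?K G"
        using K(3) by (auto simp: subgraph_def)
      have KK: "subgraph K ?K"
        using K(3) by (rule subgraph_induce_subgraphI2)
      have "connected ?K"
        using mono KK \<open>connected K\<close> unfolding arc_mono_def by fastforce
      then have "strongly_connected ?K"
        using ind strong by blast
      moreover have "subgraph H ?K"
        using K(2) KK by (rule subgraph_trans)
      ultimately have "H = ?K"
        using H ind by (auto simp: max_subgraph_def)
      with K(2) KK have "H = K"
        by (auto simp: subgraph_def compatible_def)
      with K(1) show False by blast
    qed
  qed
  \<comment> \<open>A maximal connected subgraph is induced, because adding arcs on the same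
    vertices preserves connectivity.\<close>
  moreover have "max_subgraph strongly_connected H" if "max_subgraph connected H" for H
    by (rule max_subgraph_mp[OF that conn],
        assumption, rule strong[OF induced_subgraphI_arc_mono[OF that mono] max_subgraph_prop[OF that]])
  ultimately show ?thesis
    unfolding sccs_altdef2 by blast
qed

section \<open>The weight condition and the shape of components\<close>

text \<open>The product form makes sense with zero divisors, so one definition serves both the
  vector weights and their scalar coordinates.\<close>

definition equal_weights_across_edges :: "'v set \<Rightarrow> ('v \<Rightarrow> 'v \<Rightarrow> 'a::ring) \<Rightarrow> bool" where
  "equal_weights_across_edges V u \<longleftrightarrow>
     (\<forall>i\<in>V. \<forall>j\<in>V. \<forall>k\<in>V. i \<noteq> j \<and> i \<noteq> k \<and> j \<noteq> k \<longrightarrow> u j k * (u i j - u i k) = 0)"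

lemma equal_weights_across_edgesD:
  assumes "equal_weights_across_edges V u"
    and "i \<in> V" "j \<in> V" "k \<in> V" "i \<noteq> j" "i \<noteq> k" "j \<noteq> k"
  shows "u j k * (u i j - u i k) = 0"
  using assms by (simp add: equal_weights_across_edges_def)

lemma weight_graph_simps [simp]:
  "verts (weight_graph V u) = V"
  "arcs (weight_graph V u) = {(i, j). i \<in> V \<and> j \<in> V \<and> u i j \<noteq> 0}"
  "arcs_ends (weight_graph V u) = {(i, j). i \<in> V \<and> j \<in> V \<and> u i j \<noteq> 0}"
  "tail (weight_graph V u) = fst"
  "head (weight_graph V u) = snd"
  by (auto simp: weight_graph_def)

text \<open>Under the weight condition walks shorten to single edges, so components are complete.
  Conversely, for an edge \<open>j k\<close> one inspects the component containing it: a third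
  vertex \<open>i\<close> lies outside, with both weights zero, or in a complete graph of constant
  weight.\<close>

lemma components_iff_equal_weights:
  fixes u :: "'v \<Rightarrow> 'v \<Rightarrow> complex"
  assumes fin: "finite V"
    and sym: "\<And>i j. i \<in> V \<Longrightarrow> j \<in> V \<Longrightarrow> u i j = u j i"
    and diag: "\<And>i. i \<in> V \<Longrightarrow> u i i = 0"
  shows "(\<forall>H. connected_component_of_graph (weight_graph V u) H \<longrightarrow>
       isolated_vertex H \<or> single_edge H \<or> complete_with_common_weight u H)
     \<longleftrightarrow> equal_weights_across_edges V u"
proof -
  let ?G = "weight_graph V u"
  interpret G: sym_digraph ?G
    by unfold_locales (auto simp: symmetric_def sym_def sym)
  have comp: "connected_component_of_graph ?G H \<longleftrightarrow> H \<in> G.sccs" for H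
    using G.max_connected_subgraph_eq_sccs by (auto simp: connected_component_of_graph_def)
  show ?thesis
  proof
    assume eq: "equal_weights_across_edges V u"
    have adj: "i = j \<or> u i j \<noteq> 0" if "i \<rightarrow>\<^sup>*\<^bsub>?G\<^esub> j" for i j
      using that
    proof (induction rule: G.reachable_induct)
      case (step x y)
      have "i \<in> V" using step.hyps(1) by (auto elim: reachable_in_vertsE)
      moreover have "x \<in> V" "y \<in> V" "u x y \<noteq> 0" using step.hyps(2) by auto
      ultimately show ?case
        using equal_weights_across_edgesD[OF eq, of i x y] step.IH diag[of x]
        by (cases "i = x"; cases "i = y"; cases "x = y") auto
    qed simp
    \<comment> \<open>Isolated vertices and single edges are the complete graphs on one and two
      vertices, so the last alternative always holds.\<close>
    have "complete_with_common_weight u H" if H: "H \<in> G.sccs" for H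
    proof -
      let ?S = "verts H"
      have ind: "induced_subgraph H ?G" and sc: "strongly_connected H"
        using H by (auto simp: G.sccs_def)
      have sub: "?S \<subseteq> V"
        using ind by (auto simp: induced_subgraph_def subgraph_def)
      have nz: "u i j \<noteq> 0" if "i \<in> ?S" "j \<in> ?S" "i \<noteq> j" for i j
        using that sc adj G.reachable_mono[OF _ induced_imp_subgraph[OF ind]]
        unfolding strongly_connected_def by blast
      have HS: "H = with_proj \<lparr>pverts = ?S, parcs = {(i, j). (i, j) \<in> ?S \<times> ?S \<and> i \<noteq> j}\<rparr>"
      proof (rule pre_digraph.equality)
        show "arcs H = arcs (with_proj \<lparr>pverts = ?S, parcs = {(i, j). (i, j) \<in> ?S \<times> ?S \<and> i \<noteq> j}\<rparr>)"
          using ind sub nz diag by (auto simp: induced_subgraph_def)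
      qed (use ind in \<open>simp_all add: induced_subgraph_def subgraph_def compatible_def\<close>)
      have "complete_digraph (card ?S) H"
        by (subst HS, subst complete_digraph_pair_def)
          (use fin sub in \<open>auto intro: finite_subset\<close>)
      moreover have ends: "arcs_ends H = {(i, j). (i, j) \<in> ?S \<times> ?S \<and> i \<noteq> j}"
        using arg_cong[OF HS, of arcs_ends] by simp
      have star: "u i j = u i k"
        if "i \<in> ?S" "j \<in> ?S" "k \<in> ?S" "i \<noteq> j" "i \<noteq> k" for i j k
      proof (cases "j = k")
        case False
        then have "u j k * (u i j - u i k) = 0"
          using equal_weights_across_edgesD[OF eq] that sub by blast
        then show ?thesis
          using nz[OF that(2,3) False] by simp
      qed simp
      have "u i j = u k l"
        if "i \<in> ?S" "j \<in> ?S" "k \<in> ?S" "l \<in> ?S" "i \<noteq> j" "k \<noteq> l" for i j k l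
      proof (cases "i = k")
        case True
        then show ?thesis using that star by blast
      next
        case False
        \<comment> \<open>Edges with different first vertices are compared through the edge joining
          these vertices.\<close>
        then have "u i j = u i k" "u k i = u k l" using that star by blast+
        moreover have "u i k = u k i" using that sub sym by blast
        ultimately show ?thesis by simp
      qed
      then have const: "u i j = u k l"
        if "(i, j) \<in> arcs_ends H" "(k, l) \<in> arcs_ends H" for i j k l
        using that unfolding ends by blast
      have "\<exists>c. \<forall>(i, j) \<in> arcs_ends H. u i j = c"
      proof (cases "arcs_ends H = {}")
        case False
        then obtain k l where "(k, l) \<in> arcs_ends H" by auto
        with const show ?thesis by blast
      qed simp
      ultimately show ?thesis
        unfolding complete_with_common_weight_def by blast
    qed
    then show "\<forall>H. connected_component_of_graph ?G H \<longrightarrow>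
        isolated_vertex H \<or> single_edge H \<or> complete_with_common_weight u H"
      by (simp add: comp)
  next
    assume *: "\<forall>H. connected_component_of_graph ?G H \<longrightarrow>
        isolated_vertex H \<or> single_edge H \<or> complete_with_common_weight u H"
    have "u i j = u i k"
      if V: "i \<in> V" "j \<in> V" "k \<in> V" and ne: "i \<noteq> j" "i \<noteq> k" and jk: "u j k \<noteq> 0" for i j k
    proof -
      define S where "S = {v. j \<rightarrow>\<^sup>*\<^bsub>?G\<^esub> v}"
      define H where "H = ?G \<restriction> S"
      have "H \<in> G.sccs"
        unfolding H_def S_def using V by (intro G.induce_reachable_is_in_sccs) simp
      then have cases: "isolated_vertex H \<or> single_edge H \<or> complete_with_common_weight u H"
        using * comp by blast
      have jS: "j \<in> S" and kS: "k \<in> S"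
        using V jk by (auto simp: S_def)
      have closed: "y \<in> S" if "x \<in> S" "y \<in> V" "u x y \<noteq> 0" for x y
      proof -
        have "j \<rightarrow>\<^sup>*\<^bsub>?G\<^esub> x" using that(1) by (simp add: S_def)
        moreover from this have "x \<in> V" by (auto elim: reachable_in_vertsE)
        then have "x \<rightarrow>\<^bsub>?G\<^esub> y" using that by simp
        ultimately show ?thesis
          unfolding S_def by (blast intro: G.reachable_adj_trans)
      qed
      have outside: ?thesis if "i \<notin> S"
      proof -
        have "u j i = 0" "u k i = 0"
          using that closed[OF jS V(1)] closed[OF kS V(1)] by blast+
        then show ?thesis
          using sym[OF V(1,2)] sym[OF V(1,3)] by simp
      qed
      have "(j, k) \<in> arcs H"
        using V jk jS kS by (auto simp: H_def)
      then have "\<not> isolated_vertex H"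
        by (auto simp: isolated_vertex_def)
      with cases consider "single_edge H" | "complete_with_common_weight u H" by blast
      then show ?thesis
      proof cases
        case 1
        then obtain a b where "S = {a, b}"
          by (auto simp: single_edge_def H_def)
        moreover have "j \<noteq> k" using V jk diag by blast
        \<comment> \<open>The two vertices of \<open>S\<close> are already \<open>j\<close> and
          \<open>k\<close>.\<close>
        ultimately have "i \<notin> S" using jS kS ne by auto
        then show ?thesis by (rule outside)
      next
        case 2
        then obtain c where c: "\<And>x y. (x, y) \<in> arcs_ends H \<Longrightarrow> u x y = c"
          and ends: "arcs_ends H = {(x, y). (x, y) \<in> S \<times> S \<and> x \<noteq> y}"
          by (auto simp: complete_with_common_weight_def complete_digraph_def H_def)
        show ?thesis
        proof (cases "i \<in> S")
          case True
          then show ?thesis using c ends jS kS ne by simp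
        qed (rule outside)
      qed
    qed
    then show "equal_weights_across_edges V u"
      unfolding equal_weights_across_edges_def by (metis mult_eq_0_iff right_minus_eq)
  qed
qed

section \<open>The Jacobi identity in terms of the weights\<close>

lemma graph_bracket_apply:
  assumes "i \<in> V"
  shows "graph_bracket V w f g i = f i * (\<Sum>j\<in>V. w i j * g j) - g i * (\<Sum>j\<in>V. w i j * f j)"
  using assms by (simp add: graph_bracket_def algebra_simps sum_distrib_left sum_subtractf)

text \<open>The coefficient of \<open>g j * h k\<close> on the left, antisymmetrised in
  \<open>j\<close> and \<open>k\<close>, vanishes unless exactly one of \<open>j\<close>,
  \<open>k\<close> equals \<open>i\<close>. The surviving terms carry squared weights.\<close>

lemma equal_weights_sum_bracket:
  fixes w :: "'v \<Rightarrow> 'v \<Rightarrow> complex ^ 'q"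
  assumes fin: "finite V"
    and sym: "\<And>i j. i \<in> V \<Longrightarrow> j \<in> V \<Longrightarrow> w i j = w j i"
    and diag: "\<And>i. i \<in> V \<Longrightarrow> w i i = 0"
    and eq: "equal_weights_across_edges V w"
    and i: "i \<in> V"
  shows "(\<Sum>j\<in>V. w i j * graph_bracket V w g h j)
    = h i * (\<Sum>j\<in>V. w i j * w i j * g j) - g i * (\<Sum>j\<in>V. w i j * w i j * h j)"
proof -
  have pt: "w i j * w j k - w i k * w k j
      = (if k = i then w i j * w i j else 0) - (if j = i then w i k * w i k else 0)"
    if "j \<in> V" "k \<in> V" for j k
  proof -
    have "w j k * (w i j - w i k) = 0" if "i \<noteq> j" "i \<noteq> k" "j \<noteq> k"
      using equal_weights_across_edgesD[OF eq i] \<open>j \<in> V\<close> \<open>k \<in> V\<close> that by blast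
    then show ?thesis
      using sym[OF i \<open>j \<in> V\<close>] sym[OF i \<open>k \<in> V\<close>] sym[OF that] diag[OF i] diag[OF \<open>j \<in> V\<close>]
      by (cases "i = j"; cases "i = k"; cases "j = k") (auto simp: algebra_simps)
  qed
  have "(\<Sum>j\<in>V. w i j * graph_bracket V w g h j)
      = (\<Sum>j\<in>V. \<Sum>k\<in>V. w i j * w j k * g j * h k) - (\<Sum>j\<in>V. \<Sum>k\<in>V. w i j * w j k * h j * g k)"
    by (simp add: graph_bracket_apply algebra_simps sum_distrib_left sum_subtractf cong: sum.cong)
  \<comment> \<open>Exchanging the roles of \<open>j\<close> and \<open>k\<close> gives both double
    sums the common factor \<open>g j * h k\<close>.\<close>
  also have "(\<Sum>j\<in>V. \<Sum>k\<in>V. w i j * w j k * h j * g k) = (\<Sum>j\<in>V. \<Sum>k\<in>V. w i k * w k j * h k * g j)"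
    by (rule sum.swap)
  also have "(\<Sum>j\<in>V. \<Sum>k\<in>V. w i j * w j k * g j * h k) - \<dots>
      = (\<Sum>j\<in>V. \<Sum>k\<in>V. (w i j * w j k - w i k * w k j) * (g j * h k))"
    by (simp add: algebra_simps sum_subtractf)
  also have "\<dots> = (\<Sum>j\<in>V. \<Sum>k\<in>V. (if k = i then w i j * w i j * (g j * h k) else 0)
      - (if j = i then w i k * w i k * (g j * h k) else 0))"
    by (intro sum.cong refl) (auto simp: pt left_diff_distrib)
  also have "\<dots> = (\<Sum>j\<in>V. \<Sum>k\<in>V. if k = i then w i j * w i j * (g j * h k) else 0)
      - (\<Sum>j\<in>V. \<Sum>k\<in>V. if j = i then w i k * w i k * (g j * h k) else 0)"
    by (simp only: sum_subtractf)
  also have "(\<Sum>j\<in>V. \<Sum>k\<in>V. if j = i then w i k * w i k * (g j * h k) else 0)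
      = (\<Sum>k\<in>V. \<Sum>j\<in>V. if j = i then w i k * w i k * (g j * h k) else 0)"
    by (rule sum.swap)
  also have "(\<Sum>j\<in>V. \<Sum>k\<in>V. if k = i then w i j * w i j * (g j * h k) else 0) - \<dots>
      = h i * (\<Sum>j\<in>V. w i j * w i j * g j) - g i * (\<Sum>j\<in>V. w i j * w i j * h j)"
    using fin i by (simp add: sum.delta sum_distrib_left algebra_simps)
  finally show ?thesis .
qed

text \<open>The Jacobi identity is tested on the unit vectors at \<open>i\<close>, \<open>j\<close>,
  \<open>k\<close> and read off at \<open>i\<close>.\<close>

lemma jacobi_imp_equal_weights:
  fixes w :: "'v \<Rightarrow> 'v \<Rightarrow> complex ^ 'q"
  assumes fin: "finite V"
    and sym: "\<And>i j. i \<in> V \<Longrightarrow> j \<in> V \<Longrightarrow> w i j = w j i"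
    and diag: "\<And>i. i \<in> V \<Longrightarrow> w i i = 0"
    and jac: "jacobi_identity V (graph_bracket V w)"
  shows "equal_weights_across_edges V w"
  unfolding equal_weights_across_edges_def
proof (intro ballI impI, elim conjE)
  fix i j k
  assume V: "i \<in> V" "j \<in> V" "k \<in> V" and ne: "i \<noteq> j" "i \<noteq> k" "j \<noteq> k"
  define d :: "'v \<Rightarrow> 'v \<Rightarrow> complex ^ 'q" where "d a = (\<lambda>m\<in>V. if m = a then 1 else 0)" for a
  have d_ext: "d a \<in> V \<rightarrow>\<^sub>E UNIV" for a
    by (simp add: d_def)
  have d_val: "d a m = (if m = a then 1 else 0)" if "m \<in> V" for a m
    using that by (simp add: d_def)
  have d_sum: "(\<Sum>m\<in>V. w a m * d b m) = w a b" if "b \<in> V" for a b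
    using that fin by (simp add: d_val if_distrib cong: if_cong sum.cong)
  have br: "graph_bracket V w (d a) (d b) m
      = (if m = a then w a b else 0) - (if m = b then w b a else 0)"
    if "a \<in> V" "b \<in> V" "m \<in> V" for a b m
    unfolding graph_bracket_apply[OF that(3)] d_sum[OF that(1)] d_sum[OF that(2)]
    using that by (simp add: d_val)
  have br_sum: "(\<Sum>m\<in>V. w c m * graph_bracket V w (d a) (d b) m) = w c a * w a b - w c b * w b a"
    if "a \<in> V" "b \<in> V" for a b c
  proof -
    have "(\<Sum>m\<in>V. w c m * graph_bracket V w (d a) (d b) m)
        = (\<Sum>m\<in>V. (if m = a then w c a * w a b else 0) - (if m = b then w c b * w b a else 0))"
      by (intro sum.cong refl) (auto simp: br[OF that] right_diff_distrib)
    then show ?thesis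
      using that fin by (simp add: sum_subtractf)
  qed
  have "graph_bracket V w (d i) (graph_bracket V w (d j) (d k)) i
      + graph_bracket V w (d j) (graph_bracket V w (d k) (d i)) i
      + graph_bracket V w (d k) (graph_bracket V w (d i) (d j)) i = 0"
    using jac d_ext V(1) unfolding jacobi_identity_def by blast
  \<comment> \<open>The first two terms come from the bracket with \<open>d i\<close> outside. The
    last two come from the other brackets and cancel.\<close>
  then have "w i j * w j k - w i k * w k j + w i k * w i j - w i j * w i k = 0"
    unfolding graph_bracket_apply[OF V(1)] br_sum[OF V(2,3)] br_sum[OF V(3,1)] br_sum[OF V(1,2)]
      V[THEN d_sum]
    using V ne by (simp add: d_val)
  then show "w j k * (w i j - w i k) = 0"
    using sym[OF V(2,3)] by (simp add: algebra_simps)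
qed

lemma jacobi_iff_equal_weights:
  fixes w :: "'v \<Rightarrow> 'v \<Rightarrow> complex ^ 'q"
  assumes "finite V"
    and "\<And>i j. i \<in> V \<Longrightarrow> j \<in> V \<Longrightarrow> w i j = w j i"
    and "\<And>i. i \<in> V \<Longrightarrow> w i i = 0"
  shows "jacobi_identity V (graph_bracket V w) \<longleftrightarrow> equal_weights_across_edges V w"
proof
  assume eq: "equal_weights_across_edges V w"
  show "jacobi_identity V (graph_bracket V w)"
    unfolding jacobi_identity_def
  proof (intro ballI)
    fix f g h i
    assume i: "i \<in> V"
    have S: "(\<Sum>j\<in>V. w i j * graph_bracket V w a b j)
        = b i * (\<Sum>j\<in>V. w i j * w i j * a j) - a i * (\<Sum>j\<in>V. w i j * w i j * b j)" for a b
      using equal_weights_sum_bracket[OF assms eq i] .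
    show "graph_bracket V w f (graph_bracket V w g h) i
        + graph_bracket V w g (graph_bracket V w h f) i
        + graph_bracket V w h (graph_bracket V w f g) i = 0"
      \<comment> \<open>With \<open>L\<close> and \<open>M\<close> the operators of weights and
        squared weights, the terms \<open>f (h Mg - g Mh)\<close> and the terms
        \<open>(g Lh - h Lg) Lf\<close> cancel separately in the cyclic sum.\<close>
      unfolding graph_bracket_apply[OF i] S by (simp add: algebra_simps)
  qed
qed (rule jacobi_imp_equal_weights[OF assms])

section \<open>Reduction to scalar coordinates\<close>

theorem theorem2p3:
  fixes V :: "'v set"
    and \<epsilon> :: "'q::finite \<Rightarrow> complex ^ 'q"
    and w :: "'v \<Rightarrow> 'v \<Rightarrow> complex ^ 'q"
    and wc :: "'q \<Rightarrow> 'v \<Rightarrow> 'v \<Rightarrow> complex"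
  assumes "finite V"
    and "bij_betw \<epsilon> UNIV {e. primitive_idempotent e}"
    and "\<And>i j. i \<in> V \<Longrightarrow> j \<in> V \<Longrightarrow> w i j = w j i"
    and "\<And>i. i \<in> V \<Longrightarrow> w i i = 0"
    and "\<And>i j. i \<in> V \<Longrightarrow> j \<in> V \<Longrightarrow> w i j = (\<Sum>\<alpha>\<in>UNIV. wc \<alpha> i j *s \<epsilon> \<alpha>)"
  shows "jacobi_identity V (graph_bracket V w) \<longleftrightarrow>
    (\<forall>\<alpha>. \<forall>H. connected_component_of_graph (weight_graph V (wc \<alpha>)) H \<longrightarrow>
       isolated_vertex H \<or> single_edge H \<or> complete_with_common_weight (wc \<alpha>) H)"
proof -
  have "\<exists>a. \<epsilon> \<alpha> = axis a 1" for \<alpha>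
    using bij_betwE[OF assms(2)] by (simp add: primitive_idempotent_iff_axis)
  \<comment> \<open>The idempotents may be listed in any order. The map \<open>p\<close> is the
    resulting permutation of the coordinates, so \<open>wc \<alpha>\<close> is coordinate
    \<open>p \<alpha>\<close> of \<open>w\<close>.\<close>
  then obtain p where p: "\<And>\<alpha>. \<epsilon> \<alpha> = axis (p \<alpha>) 1" by metis
  have "inj p"
    using bij_betw_imp_inj_on[OF assms(2)] p by (metis injD injI)
  then have "surj p"
    by (rule finite_UNIV_inj_surj[OF finite])
  have nth: "w i j $ p \<alpha> = wc \<alpha> i j" if "i \<in> V" "j \<in> V" for i j \<alpha>
  proof -
    have "w i j $ p \<alpha> = (\<Sum>\<beta>\<in>UNIV. if \<alpha> = \<beta> then wc \<beta> i j else 0)"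
      using assms(5)[OF that] inj_eq[OF \<open>inj p\<close>]
      by (simp add: p axis_def if_distrib cong: if_cong)
    then show ?thesis by simp
  qed
  have vec_zero: "x = 0 \<longleftrightarrow> (\<forall>\<alpha>. x $ p \<alpha> = 0)" for x :: "complex ^ 'q"
    using \<open>surj p\<close> by (metis surjD vec_eq_iff zero_index)
  have "equal_weights_across_edges V w \<longleftrightarrow> (\<forall>\<alpha>. equal_weights_across_edges V (wc \<alpha>))"
    unfolding equal_weights_across_edges_def by (auto simp: vec_zero nth)
  moreover have "equal_weights_across_edges V (wc \<alpha>) \<longleftrightarrow>
      (\<forall>H. connected_component_of_graph (weight_graph V (wc \<alpha>)) H \<longrightarrow>
        isolated_vertex H \<or> single_edge H \<or> complete_with_common_weight (wc \<alpha>) H)" for \<alpha>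
    using assms(1,3,4) nth
    by (intro components_iff_equal_weights[symmetric]) (metis zero_index)+
  ultimately show ?thesis
    using jacobi_iff_equal_weights[OF assms(1,3,4)] by simp
qed

end
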